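(* For each $m\ge 2$, the stepping sequence $R_m$ is strongly contiguous, and hence gives rise to a cyclic Gray-code ordering on the $m$-bit integers. More generally, if $A$ and $B$ are strongly contiguous stepping sequences for $m-1$, then $C=(A+1)\cup[1,2,\ldots,m-1]\cup B$ is a strongly contiguous stepping sequence for $m$.
   Context: Let $n\ge1$ and start with the chain $S_i=\{0,1,\ldots,i-1\}$, $0\le i\le n$. A move with index $i$ ($1\le i\le n-1$) replaces $S_i$ by $S_{i-1}\cup(S_{i+1}\setminus S_i)$; the set produced is the new $S_i$. A sequence $[i_1,\ldots,i_N]$ with entries in $\{1,\ldots,n-1\}$ is a stepping sequence for $n$ if the initial sets $S_0,\ldots,S_n$ together with the sets produced by the successive moves $i_1,\ldots,i_N$ contain every subset of $\{0,\ldots,n-1\}$ exactly once. The stepping sequence gives rise to the list of $n$-bit integers obtained by mapping each set $S$ to $\sum_{i\in S}2^i$ in the order $S_0,S_1,\ldots,S_n$ (initial sets) followed by the produced sets; this is a cyclic Gray-code ordering if consecutive integers, and also the last and first integers, differ in exactly one bit. A sequence is contiguous if consecutive entries differ by $\pm1$; a stepping sequence for $n$ is strongly contiguous if it is contiguous, begins with $n-1$ and ends with $1$. $\cup$ is concatenation and $A+1$ adds $1$ to each entry of $A$. The sequences $R_m$ are defined by $R_2=[1]$ and $R_m=(R_{m-1}+1)\cup[1,2,\ldots,m-1]\cup R_{m-1}$ for $m\ge 3$. *)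

theory Defs
  imports Main
begin

text \<open>A chain is a family \<open>S 0, ..., S n\<close> of sets of naturals, represented by a function on all
  of \<open>nat\<close>. Indices above \<open>n\<close> play no role: a move with index \<open>i \<le> n - 1\<close> reads and writes only
  indices up to \<open>n\<close>.\<close>

definition initial_chain :: "nat \<Rightarrow> nat set" where
  "initial_chain i = {0..<i}"

definition move :: "nat \<Rightarrow> (nat \<Rightarrow> nat set) \<Rightarrow> (nat \<Rightarrow> nat set)" where
  "move i S = S(i := S (i - 1) \<union> (S (i + 1) - S i))"

fun produced_sets :: "(nat \<Rightarrow> nat set) \<Rightarrow> nat list \<Rightarrow> nat set list" where
  "produced_sets S [] = []"
| "produced_sets S (i # xs) = move i S i # produced_sets (move i S) xs"

definition all_sets :: "nat \<Rightarrow> nat list \<Rightarrow> nat set list" where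
  "all_sets n xs = map initial_chain [0..<Suc n] @ produced_sets initial_chain xs"

definition stepping_sequence :: "nat \<Rightarrow> nat list \<Rightarrow> bool" where
  "stepping_sequence n xs \<longleftrightarrow>
     set xs \<subseteq> {1..n - 1} \<and> (\<forall>X. X \<subseteq> {0..<n} \<longrightarrow> count_list (all_sets n xs) X = 1)"

definition contiguous :: "nat list \<Rightarrow> bool" where
  "contiguous xs \<longleftrightarrow> successively (\<lambda>i j. j = i + 1 \<or> i = j + 1) xs"

definition strongly_contiguous :: "nat \<Rightarrow> nat list \<Rightarrow> bool" where
  "strongly_contiguous n xs \<longleftrightarrow> contiguous xs \<and> xs \<noteq> [] \<and> hd xs = n - 1 \<and> last xs = 1"

definition set_to_nat :: "nat set \<Rightarrow> nat" where
  "set_to_nat X = (\<Sum>i\<in>X. 2 ^ i)"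

definition integer_list :: "nat \<Rightarrow> nat list \<Rightarrow> nat list" where
  "integer_list n xs = map set_to_nat (all_sets n xs)"

definition differ_in_one_bit :: "nat \<Rightarrow> nat \<Rightarrow> bool" where
  "differ_in_one_bit x y \<longleftrightarrow> (\<exists>!k. bit x k \<noteq> bit y k)"

definition cyclic_gray_code :: "nat \<Rightarrow> nat list \<Rightarrow> bool" where
  "cyclic_gray_code n ys \<longleftrightarrow>
     distinct ys \<and> set ys = {0..<2 ^ n} \<and>
     successively differ_in_one_bit ys \<and> differ_in_one_bit (last ys) (hd ys)"

text \<open>The sequences start at index 2; the values at 0 and 1 are dummies.\<close>

fun R_seq :: "nat \<Rightarrow> nat list" where
  "R_seq 0 = []"
| "R_seq (Suc 0) = []"
| "R_seq (Suc (Suc 0)) = [1]"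
| "R_seq (Suc (Suc (Suc k))) =
     map Suc (R_seq (Suc (Suc k))) @ [1..<Suc (Suc (Suc k))] @ R_seq (Suc (Suc k))"

end

(* A chain is always of the form p ` {0..<i} for an injective labelling p, and a move transposes
   two neighbouring labels.  During A + 1 the label 0 stays in front, so this phase
   produces the images under X |-> {0} \<union> (X + 1) of what A produces: all sets containing 0.  The sweep
   1, ..., m - 1 carries 0 to the back and leaves a relabelling of the initial chain on
   the remaining m - 1 labels, on which B then produces all sets without 0.
   The Gray-code property holds because a contiguous sequence lists neighbouring members
   of one and the same chain. *)
theory Submission
  imports Defs "HOL-Library.Nat_Bijection" "HOL-Combinatorics.Transposition"
begin

section \<open>Chains and moves\<close>

text \<open>A maximal chain, given as the prefixes of a labelling. The labelling is total on
  \<open>nat\<close>, so no length bound has to be carried along.\<close>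

definition flag :: "(nat \<Rightarrow> nat set) \<Rightarrow> bool" where
  "flag S \<longleftrightarrow> (\<exists>p. inj p \<and> S = (\<lambda>i. p ` {0..<i}))"

lemma flag_initial_chain: "flag initial_chain"
  unfolding flag_def initial_chain_def by (rule exI[of _ id]) auto

lemma flag_zero: "flag S \<Longrightarrow> S 0 = {}"
  by (auto simp: flag_def)

lemma flag_mono: "flag S \<Longrightarrow> i \<le> j \<Longrightarrow> S i \<subseteq> S j"
  by (auto simp: flag_def)

lemma flag_move:
  assumes "flag S" "i \<ge> 1"
  shows "flag (move i S)"
proof -
  from assms obtain p where p: "inj p" and S: "S = (\<lambda>i. p ` {0..<i})"
    by (auto simp: flag_def)
  from \<open>i \<ge> 1\<close> obtain k where i: "i = Suc k" by (cases i) auto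
  \<comment> \<open>Only the prefix of length \<open>Suc k\<close> changes: it loses
    \<open>p k\<close> and gains \<open>p (Suc k)\<close>. Every other prefix contains both swapped
    positions or neither.\<close>
  define q where "q = p \<circ> transpose k (Suc k)"
  have "inj q"
    unfolding q_def by (intro inj_compose p) simp
  moreover have "move i S j = q ` {0..<j}" for j
  proof (cases "j = Suc k")
    case True
    have "move i S j = p ` {0..<k} \<union> (p ` {0..<Suc (Suc k)} - p ` {0..<Suc k})"
      by (simp add: move_def S i True)
    also have "\<dots> = p ` ({0..<k} \<union> ({0..<Suc (Suc k)} - {0..<Suc k}))"
      by (simp only: image_Un image_set_diff[OF p])
    also have "{0..<k} \<union> ({0..<Suc (Suc k)} - {0..<Suc k}) = insert (Suc k) {0..<k}"
      by auto
    also have "\<dots> = transpose k (Suc k) ` insert k {0..<k}"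
      by (simp add: transpose_image_eq)
    also have "insert k {0..<k} = {0..<j}"
      by (simp add: True atLeast0_lessThan_Suc)
    finally show ?thesis by (simp only: q_def image_comp)
  next
    case False
    then have "transpose k (Suc k) ` {0..<j} = {0..<j}"
      by (intro transpose_image_eq) auto
    then show ?thesis
      using False unfolding q_def image_comp[symmetric] by (simp add: move_def S i)
  qed
  ultimately show ?thesis unfolding flag_def by blast
qed

lemma flag_fold_move:
  "flag S \<Longrightarrow> 0 \<notin> set xs \<Longrightarrow> flag (fold move xs S)"
  by (induction xs arbitrary: S) (auto simp: flag_move Suc_le_eq)

lemma fold_move_unchanged: "n \<notin> set xs \<Longrightarrow> fold move xs S n = S n"
  by (induction xs arbitrary: S) (auto simp: move_def)

section \<open>Produced sets under concatenation, truncation and relabelling\<close>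

lemma produced_sets_append:
  "produced_sets S (xs @ ys) = produced_sets S xs @ produced_sets (fold move xs S) ys"
  by (induction xs arbitrary: S) auto

lemma last_produced_sets:
  "xs \<noteq> [] \<Longrightarrow> last (produced_sets S xs) = fold move xs S (last xs)"
proof (induction xs arbitrary: S)
  case (Cons i xs)
  then show ?case by (cases xs) auto
qed simp

lemma produced_sets_eq_Nil_iff [simp]: "produced_sets S xs = [] \<longleftrightarrow> xs = []"
  by (cases xs) auto

text \<open>A move with index below \<open>n\<close> reads and writes nothing above
  \<open>n\<close>, so agreement up to \<open>n\<close> persists. This is needed because the sweep
  yields a relabelled initial chain only up to that index.\<close>

lemma produced_sets_cong:
  assumes "\<And>i. i \<le> n \<Longrightarrow> S i = T i" "set xs \<subseteq> {..<n}"
  shows "produced_sets S xs = produced_sets T xs"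
  using assms
proof (induction xs arbitrary: S T)
  case (Cons i xs)
  have "move i S j = move i T j" if "j \<le> n" for j
    using Cons.prems that by (auto simp: move_def)
  note move = this
  have "produced_sets (move i S) xs = produced_sets (move i T) xs"
    using Cons.prems by (intro Cons.IH move) auto
  moreover have "move i S i = move i T i"
    using Cons.prems by (intro move) auto
  ultimately show ?case by simp
qed simp

text \<open>Injectivity lets the image pass through the set difference.\<close>

lemma move_image:
  assumes "inj f"
  shows "move i (\<lambda>j. f ` S j) = (\<lambda>j. f ` move i S j)"
  using assms by (auto simp: move_def fun_eq_iff image_Un image_set_diff)

lemma produced_sets_image:
  assumes "inj f"
  shows "produced_sets (\<lambda>j. f ` S j) xs = map ((`) f) (produced_sets S xs)"
  by (induction xs arbitrary: S) (simp_all add: move_image[OF assms])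

text \<open>The set at index \<open>n\<close> is never replaced, and each later chain still
  increases up to it. This excludes stray sets, about which the definition of a stepping sequence is
  silent.\<close>

lemma produced_sets_subset:
  assumes "flag S" "0 \<notin> set xs" "set xs \<subseteq> {..<n}" "X \<in> set (produced_sets S xs)"
  shows "X \<subseteq> S n"
  using assms
proof (induction xs arbitrary: S)
  case (Cons i xs)
  have fl: "flag (move i S)" and n: "move i S n = S n"
    using Cons.prems flag_move[of S i] by (auto simp: move_def)
  show ?case
  proof (cases "X = move i S i")
    case True
    then show ?thesis using flag_mono[OF fl, of i n] n Cons.prems by auto
  next
    case False
    then show ?thesis using Cons.IH[OF fl] Cons.prems n by auto
  qed
qed simp

section \<open>The three phases of the composed sequence\<close>

definition cone :: "nat set \<Rightarrow> nat set" where
  "cone X = insert 0 (Suc ` X)"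

lemma inj_cone: "inj cone"
  by (auto simp: cone_def inj_def)

text \<open>A difference of two cones loses 0, but the union with the lower cone restores it. As
  \<open>xs\<close> avoids 0, the shifted moves never read \<open>T 0\<close>, which need not be a
  cone.\<close>

lemma cone_shift:
  assumes "\<And>j. T (Suc j) = cone (S j)" "0 \<notin> set xs"
  shows "produced_sets T (map Suc xs) = map cone (produced_sets S xs)"
    and "fold move (map Suc xs) T (Suc j) = cone (fold move xs S j)"
proof -
  have "produced_sets T (map Suc xs) = map cone (produced_sets S xs) \<and>
        (\<forall>j. fold move (map Suc xs) T (Suc j) = cone (fold move xs S j))"
    using assms
  proof (induction xs arbitrary: S T)
    case (Cons i xs)
    obtain k where k: "i = Suc k" using Cons.prems by (cases i) auto
    have "move (Suc i) T (Suc j) = cone (move i S j)" for j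
      using Cons.prems(1) by (auto simp: move_def cone_def k)
    then show ?case using Cons.IH[of "move (Suc i) T" "move i S"] Cons.prems by simp
  qed simp
  then show "produced_sets T (map Suc xs) = map cone (produced_sets S xs)"
    "fold move (map Suc xs) T (Suc j) = cone (fold move xs S j)" by auto
qed

text \<open>When the sweep reaches \<open>Suc k\<close>, the set below is already free of 0. The
  difference of the two cones above also drops 0 and leaves the shifted increment from
  \<open>S k\<close> to \<open>S (Suc k)\<close>, so the union is the shifted
  \<open>S (Suc k)\<close>.\<close>

lemma sweep:
  assumes "T 0 = {}" "\<And>j. T (Suc j) = cone (S j)" "flag S"
  shows "produced_sets T [1..<Suc k] = map (\<lambda>i. Suc ` S i) [1..<Suc k]"
    and "fold move [1..<Suc k] T i = (if i \<le> k then Suc ` S i else T i)"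
proof -
  have "produced_sets T [1..<Suc k] = map (\<lambda>i. Suc ` S i) [1..<Suc k] \<and>
        fold move [1..<Suc k] T = (\<lambda>i. if i \<le> k then Suc ` S i else T i)"
  proof (induction k)
    case 0
    then show ?case using assms flag_zero by (auto simp: fun_eq_iff)
  next
    case (Suc k)
    let ?F = "\<lambda>i. if i \<le> k then Suc ` S i else T i"
    have "move (Suc k) ?F (Suc k) = Suc ` S (Suc k)"
      using assms(2) flag_mono[OF \<open>flag S\<close>, of k "Suc k"] by (auto simp: move_def cone_def)
    moreover from this
    have "move (Suc k) ?F = (\<lambda>i. if i \<le> Suc k then Suc ` S i else T i)"
      by (auto simp: move_def fun_eq_iff le_Suc_eq)
    ultimately show ?case
      using Suc by (simp add: produced_sets_append)
  qed
  then show "produced_sets T [1..<Suc k] = map (\<lambda>i. Suc ` S i) [1..<Suc k]"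
    "fold move [1..<Suc k] T i = (if i \<le> k then Suc ` S i else T i)" by auto
qed

lemma initial_chain_Suc: "initial_chain (Suc i) = cone (initial_chain i)"
  by (auto simp: initial_chain_def cone_def image_iff gr0_conv_Suc)

text \<open>The empty set opens the composed list but belongs to the half of \<open>B\<close>, so
  the list is not literally a concatenation of the two halves. Counting occurrences disregards
  this.\<close>

lemma all_sets_compose:
  assumes A: "set A \<subseteq> {1..<n}" and B: "set B \<subseteq> {1..<n}"
  obtains h where "inj h" "0 \<notin> range h" "h ` {0..<n} = {1..<Suc n}"
    "\<And>X. count_list (all_sets (Suc n) (map Suc A @ [1..<Suc n] @ B)) X =
       count_list (map cone (all_sets n A)) X + count_list (map ((`) h) (all_sets n B)) X"
proof -
  have A0: "0 \<notin> set A" and B0: "0 \<notin> set B" and An: "n \<notin> set A"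
    using A B by auto
  let ?S = "fold move A initial_chain"
  let ?T = "fold move (map Suc A) initial_chain"
  have fS: "flag ?S" by (rule flag_fold_move[OF flag_initial_chain A0])
  then obtain p where p: "inj p" and S: "?S = (\<lambda>i. p ` {0..<i})"
    by (auto simp: flag_def)
  \<comment> \<open>Index \<open>n\<close> is never moved, so the final labelling permutes
    \<open>{0..<n}\<close>.\<close>
  have "?S n = {0..<n}"
    using fold_move_unchanged[OF An] by (simp add: initial_chain_def)
  then have pn: "p ` {0..<n} = {0..<n}" by (simp add: S)
  \<comment> \<open>The labelling left after the sweep: that of the final chain of \<open>A\<close>,
    shifted past 0.\<close>
  define h where "h = Suc \<circ> p"
  have h: "inj h" using p by (simp add: h_def inj_compose)
  have h0: "0 \<notin> range h" by (auto simp: h_def)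
  have hn: "h ` {0..<n} = {1..<Suc n}"
    unfolding h_def image_comp[symmetric] pn by (simp add: image_Suc_atLeastLessThan)
  have hS: "Suc ` ?S i = h ` initial_chain i" for i
    by (simp add: S h_def image_comp initial_chain_def)
  have T0: "?T 0 = {}"
    by (subst fold_move_unchanged) (auto simp: initial_chain_def)
  \<comment> \<open>The initial chain plays both roles, since its sets from index 1 on are the cones
    over itself.\<close>
  note sh = cone_shift[where T = initial_chain and S = initial_chain, OF initial_chain_Suc A0]
  note sw = sweep[OF T0 sh(2) fS]
  have "produced_sets (fold move [1..<Suc n] ?T) B = produced_sets (\<lambda>i. h ` initial_chain i) B"
    by (rule produced_sets_cong[of n]) (use B sw(2)[of n] in \<open>auto simp: hS simp del: upt_Suc\<close>)
  then have pB: "produced_sets (fold move [1..<Suc n] ?T) B =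
      map ((`) h) (produced_sets initial_chain B)"
    by (simp add: produced_sets_image[OF h])
  \<comment> \<open>The first split separates the empty set from the cones over the initial sets of
    \<open>A\<close>. The second lets the sweep supply the nonempty initial sets for
    \<open>B\<close>.\<close>
  have upt: "[0..<Suc (Suc n)] = 0 # map Suc [0..<Suc n]" "[0..<Suc n] = 0 # [1..<Suc n]"
    by (simp_all add: map_Suc_upt upt_conv_Cons del: upt_Suc)
  have "all_sets (Suc n) (map Suc A @ [1..<Suc n] @ B) =
      {} # map cone (all_sets n A) @ map (\<lambda>i. h ` initial_chain i) [1..<Suc n]
        @ map ((`) h) (produced_sets initial_chain B)"
    unfolding all_sets_def produced_sets_append sh(1) sw(1) pB hS upt(1)
    by (simp add: comp_def initial_chain_Suc initial_chain_def[of 0] del: upt_Suc)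
  moreover have "map ((`) h) (all_sets n B) =
      {} # map (\<lambda>i. h ` initial_chain i) [1..<Suc n]
        @ map ((`) h) (produced_sets initial_chain B)"
    unfolding all_sets_def upt(2)
    by (simp add: comp_def initial_chain_def[of 0] del: upt_Suc)
  ultimately have "count_list (all_sets (Suc n) (map Suc A @ [1..<Suc n] @ B)) X =
       count_list (map cone (all_sets n A)) X + count_list (map ((`) h) (all_sets n B)) X" for X
    by (simp del: upt_Suc)
  with h h0 hn that show ?thesis by blast
qed

text \<open>Cones contain 0 and images under \<open>h\<close> never do, so each set is counted in
  one half only, and there once because both maps are injective.\<close>

lemma stepping_sequence_compose:
  assumes A: "stepping_sequence n A" and B: "stepping_sequence n B"
  shows "stepping_sequence (Suc n) (map Suc A @ [1..<Suc n] @ B)"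
proof -
  have sA: "set A \<subseteq> {1..<n}" and sB: "set B \<subseteq> {1..<n}"
    using A B by (force simp: stepping_sequence_def)+
  obtain h where h: "inj h" "0 \<notin> range h" "h ` {0..<n} = {1..<Suc n}"
    and count: "\<And>X. count_list (all_sets (Suc n) (map Suc A @ [1..<Suc n] @ B)) X =
       count_list (map cone (all_sets n A)) X + count_list (map ((`) h) (all_sets n B)) X"
    using all_sets_compose[OF sA sB] by blast
  have "count_list (all_sets (Suc n) (map Suc A @ [1..<Suc n] @ B)) X = 1"
    if X: "X \<subseteq> {0..<Suc n}" for X
  proof (cases "0 \<in> X")
    case True
    define Y where "Y = Suc -` X"
    have "x \<in> Suc ` Y" if "x \<in> X" "x \<noteq> 0" for x
      using that by (cases x) (auto simp: Y_def)
    then have XY: "X = cone Y" and Y: "Y \<subseteq> {0..<n}"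
      using True X by (auto simp: cone_def Y_def)
    have "X \<noteq> h ` Z" for Z
      using True h(2) by auto
    then have "count_list (map ((`) h) (all_sets n B)) X = 0"
      by (auto simp: count_list_0_iff)
    moreover have "count_list (map cone (all_sets n A)) X = 1"
      using A Y unfolding XY by (simp add: count_list_map_conv[OF inj_cone] stepping_sequence_def)
    ultimately show ?thesis unfolding count by simp
  next
    case False
    have "X \<subseteq> h ` {0..<n}"
    proof
      fix x assume "x \<in> X"
      then show "x \<in> h ` {0..<n}" using X False unfolding h(3) by (cases x) auto
    qed
    then obtain Y where Y: "Y \<subseteq> {0..<n}" and XY: "X = h ` Y"
      by (auto elim: subset_imageE)
    have "inj ((`) h)" using h(1) by (simp add: inj_image_eq_iff inj_def)
    then have "count_list (map ((`) h) (all_sets n B)) X = 1"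
      using B Y unfolding XY by (simp add: count_list_map_conv stepping_sequence_def)
    moreover have "count_list (map cone (all_sets n A)) X = 0"
      using False by (auto simp: cone_def count_list_0_iff)
    ultimately show ?thesis unfolding count by simp
  qed
  moreover have "set (map Suc A @ [1..<Suc n] @ B) \<subseteq> {1..Suc n - 1}"
    using sA sB by force
  ultimately show ?thesis by (simp add: stepping_sequence_def del: upt_Suc)
qed

text \<open>At the joints the entries are 2, 1 (end of the shifted \<open>A\<close>, start of the
  sweep) and \<open>n\<close>, \<open>n - 1\<close> (end of the sweep, start of
  \<open>B\<close>).\<close>

lemma strongly_contiguous_compose:
  assumes A: "stepping_sequence n A" "strongly_contiguous n A"
    and B: "strongly_contiguous n B"
  shows "strongly_contiguous (Suc n) (map Suc A @ [1..<Suc n] @ B)"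
proof -
  have [simp]: "A \<noteq> []" "B \<noteq> []" using A B by (auto simp: strongly_contiguous_def)
  \<comment> \<open>An entry between 1 and \<open>n - 1\<close> forces \<open>n \<ge> 2\<close>, so
    the sweep is nonempty and \<open>n - 1\<close> does not truncate.\<close>
  then have "hd A \<in> {1..n - 1}" using A(1) hd_in_set unfolding stepping_sequence_def by blast
  then have n: "n \<ge> 2" by auto
  have "contiguous (map Suc A)"
    using A(2) by (simp add: contiguous_def strongly_contiguous_def successively_map)
  moreover have "contiguous [1..<Suc n]"
    by (simp add: contiguous_def successively_conv_nth del: upt_Suc)
  moreover have "hd [1..<Suc n] = 1" "last [1..<Suc n] = n" "[1..<Suc n] \<noteq> []"
    using n by auto
  moreover have "hd A = n - 1" "last A = 1" "hd B = n - 1" "last B = 1" "contiguous B"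
    using A B by (auto simp: strongly_contiguous_def)
  ultimately show ?thesis
    using n by (simp add: strongly_contiguous_def contiguous_def successively_append_iff
        hd_map last_map hd_append last_append del: upt_Suc)
qed

section \<open>The Gray-code property\<close>

text \<open>The symmetric difference is a singleton; the form matches
  \<open>differ_in_one_bit\<close> with bits read as membership.\<close>

definition adjacent :: "nat set \<Rightarrow> nat set \<Rightarrow> bool" where
  "adjacent X Y \<longleftrightarrow> (\<exists>!k. (k \<in> X) \<noteq> (k \<in> Y))"

lemma adjacent_sym: "adjacent X Y \<longleftrightarrow> adjacent Y X"
  unfolding adjacent_def by metis

lemma adjacent_flag:
  assumes "flag S"
  shows "adjacent (S i) (S (Suc i))"
proof -
  obtain p where p: "inj p" "S = (\<lambda>i. p ` {0..<i})"
    using assms by (auto simp: flag_def)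
  then have "p i \<notin> S i" "S (Suc i) = insert (p i) (S i)"
    by (auto simp: inj_eq atLeast0_lessThan_Suc)
  then show ?thesis by (auto simp: adjacent_def)
qed

text \<open>The index \<open>j\<close> marks where the previously listed set stands. The next move
  acts at a neighbouring index and leaves that set in place, so both sets are neighbours in the
  chain after the move.\<close>

lemma adjacent_produced_sets:
  assumes "flag S" "0 \<notin> set xs" "contiguous (j # xs)"
  shows "successively adjacent (S j # produced_sets S xs)"
  using assms
proof (induction xs arbitrary: S j)
  case (Cons i xs)
  have fl: "flag (move i S)" using Cons.prems by (auto intro!: flag_move)
  have ij: "i = j + 1 \<or> j = i + 1" and c: "contiguous (i # xs)"
    using Cons.prems by (auto simp: contiguous_def)
  then have "move i S j = S j" by (auto simp: move_def)
  moreover have "adjacent (move i S j) (move i S i)"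
    using ij adjacent_flag[OF fl, of i] adjacent_flag[OF fl, of j] by (auto simp: adjacent_sym)
  ultimately show ?case using Cons.IH[OF fl _ c] Cons.prems by simp
qed simp

lemma all_sets_cyclic:
  assumes "set xs \<subseteq> {1..n - 1}" "strongly_contiguous n xs"
  shows "successively adjacent (all_sets n xs)"
    and "adjacent (last (all_sets n xs)) (hd (all_sets n xs))"
proof -
  have xs: "xs \<noteq> []" "0 \<notin> set xs" "contiguous xs" "hd xs = n - 1" "last xs = 1"
    using assms by (auto simp: strongly_contiguous_def)
  then have "hd xs \<in> {1..n - 1}" using assms(1) by (meson hd_in_set subsetD)
  then obtain k where n: "n = Suc k" by (cases n) auto
  \<comment> \<open>Since the first move is \<open>n - 1\<close>, the top initial set can be treated
    as the output of a move at \<open>n\<close>.\<close>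
  have "contiguous (n # xs)"
    using xs n by (cases xs) (auto simp: contiguous_def)
  then have "successively adjacent (initial_chain n # produced_sets initial_chain xs)"
    using adjacent_produced_sets flag_initial_chain xs(2) by blast
  moreover have "successively adjacent (map initial_chain [0..<n])"
    by (auto simp: successively_conv_nth adjacent_flag[OF flag_initial_chain])
  moreover have "adjacent (last (map initial_chain [0..<n])) (initial_chain n)"
    using n adjacent_flag[OF flag_initial_chain, of k] by simp
  ultimately show "successively adjacent (all_sets n xs)"
    using n by (simp add: all_sets_def successively_append_iff)
  \<comment> \<open>The last move is 1, so the last set stands at index 1 of the final chain. Index
    0 of that chain still holds the empty set that opens the list, which closes the cycle.\<close>
  have fl: "flag (fold move xs initial_chain)"
    using flag_fold_move flag_initial_chain xs(2) by blast
  have "last (all_sets n xs) = fold move xs initial_chain 1"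
    using xs by (simp add: all_sets_def last_produced_sets)
  moreover have "hd (all_sets n xs) = fold move xs initial_chain 0"
    using flag_zero[OF fl] by (simp add: all_sets_def hd_append hd_map initial_chain_def del: upt_Suc)
  ultimately show "adjacent (last (all_sets n xs)) (hd (all_sets n xs))"
    using adjacent_flag[OF fl, of 0] by (simp add: adjacent_sym)
qed

section \<open>From sets to integers\<close>

lemma set_to_nat_eq_set_encode: "set_to_nat = set_encode"
  by (simp add: set_to_nat_def set_encode_def fun_eq_iff)

lemma bit_set_encode: "finite X \<Longrightarrow> bit (set_encode X) k \<longleftrightarrow> k \<in> X"
  by (metis bit_iff_odd mem_Collect_eq set_decode_def set_encode_inverse)

lemma differ_in_one_bit_set_encode:
  "finite X \<Longrightarrow> finite Y \<Longrightarrow> differ_in_one_bit (set_encode X) (set_encode Y) \<longleftrightarrow> adjacent X Y"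
  by (simp add: differ_in_one_bit_def adjacent_def bit_set_encode)

text \<open>Inclusion and equal cardinality suffice: the full set has the largest code,
  \<open>2 ^ n - 1\<close>, and the encoding is injective on finite sets.\<close>

lemma set_encode_image_Pow: "set_encode ` Pow {0..<n} = {0..<2 ^ n}"
proof -
  have "set_encode X < 2 ^ n" if "X \<subseteq> {0..<n}" for X
  proof -
    have "set_encode X \<le> set_encode {0..<n}"
      unfolding set_encode_def using that by (auto intro: sum_mono2 simp: finite_subset)
    also have "\<dots> < 2 ^ n" by (simp add: set_encode_def sum_power2)
    finally show ?thesis .
  qed
  moreover have "card (set_encode ` Pow {0..<n}) = card {0..<2 ^ n :: nat}"
    by (subst card_image)
      (auto intro!: inj_on_subset[OF inj_on_set_encode] simp: card_Pow finite_subset)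
  ultimately show ?thesis by (intro card_subset_eq) auto
qed

lemma stepping_sequence_distinct_set:
  assumes "stepping_sequence n xs" "n \<ge> 1"
  shows "set (all_sets n xs) = Pow {0..<n}" "distinct (all_sets n xs)"
proof -
  have count: "count_list (all_sets n xs) X = 1" if "X \<subseteq> {0..<n}" for X
    using assms(1) that by (simp add: stepping_sequence_def)
  have xs: "0 \<notin> set xs" "set xs \<subseteq> {..<n}"
    using assms by (force simp: stepping_sequence_def)+
  have "X \<subseteq> {0..<n}" if "X \<in> set (all_sets n xs)" for X
    using that produced_sets_subset[OF flag_initial_chain xs]
    by (auto simp: all_sets_def initial_chain_def simp del: upt_Suc)
  moreover have "X \<in> set (all_sets n xs)" if "X \<subseteq> {0..<n}" for X
    using count[OF that] by (metis count_list_0_iff zero_neq_one)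
  ultimately show eq: "set (all_sets n xs) = Pow {0..<n}" by blast
  \<comment> \<open>The multiplicities sum to the length; as all are 1, the length is the number of
    distinct members.\<close>
  have "length (all_sets n xs) = (\<Sum>X\<in>Pow {0..<n}. count_list (all_sets n xs) X)"
    using sum_count_set[of "all_sets n xs" "Pow {0..<n}"] eq by simp
  also have "\<dots> = card (set (all_sets n xs))"
    unfolding eq using count by simp
  finally show "distinct (all_sets n xs)" by (simp add: card_distinct)
qed

lemma cyclic_gray_code_integer_list:
  assumes st: "stepping_sequence n xs" and co: "strongly_contiguous n xs" and n: "n \<ge> 1"
  shows "cyclic_gray_code n (integer_list n xs)"
proof -
  note ds = stepping_sequence_distinct_set[OF st n]
  have fin: "finite X" if "X \<in> set (all_sets n xs)" for X
    using that unfolding ds(1) by (auto intro: finite_subset)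
  have ne: "all_sets n xs \<noteq> []" by (simp add: all_sets_def)
  have "set xs \<subseteq> {1..n - 1}" using st by (simp add: stepping_sequence_def)
  note cyc = all_sets_cyclic[OF this co]
  have "inj_on set_encode (set (all_sets n xs))"
    using fin by (intro inj_on_subset[OF inj_on_set_encode]) auto
  moreover have "successively differ_in_one_bit (map set_encode (all_sets n xs))"
    unfolding successively_map
    by (rule successively_mono[OF cyc(1)]) (simp add: fin differ_in_one_bit_set_encode)
  moreover have "differ_in_one_bit (last (map set_encode (all_sets n xs)))
      (hd (map set_encode (all_sets n xs)))"
    using cyc(2) ne by (simp add: last_map hd_map fin differ_in_one_bit_set_encode)
  ultimately show ?thesis
    using ds by (simp add: cyclic_gray_code_def integer_list_def set_to_nat_eq_set_encode
        distinct_map set_encode_image_Pow)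
qed

section \<open>The sequences \<open>R_seq\<close>, by induction from 2\<close>

lemma stepping_sequence_base: "stepping_sequence 2 [1]"
proof -
  have "all_sets 2 [1] = [{}, {0}, {0, 1}, {1}]"
    by (auto simp: all_sets_def initial_chain_def move_def numeral_2_eq_2 atLeast0_lessThan_Suc)
  moreover have "X \<in> {{}, {0}, {0, 1}, {1}}" if "X \<subseteq> {0..<2}" for X :: "nat set"
  proof -
    have "X \<in> Pow {0, 1}" using that by fastforce
    then show ?thesis by (auto simp: Pow_insert)
  qed
  ultimately show ?thesis by (auto simp: stepping_sequence_def)
qed

lemma R_seq_Suc:
  "n \<ge> 2 \<Longrightarrow> R_seq (Suc n) = map Suc (R_seq n) @ [1..<Suc n] @ R_seq n"
  by (cases n rule: R_seq.cases) auto

lemma R_seq_stepping_strongly_contiguous: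
  "m \<ge> 2 \<Longrightarrow> stepping_sequence m (R_seq m) \<and> strongly_contiguous m (R_seq m)"
proof (induction m rule: dec_induct)
  case base
  have "R_seq 2 = [1]" by (simp add: numeral_2_eq_2)
  then show ?case
    using stepping_sequence_base by (simp add: strongly_contiguous_def contiguous_def)
next
  case (step n)
  then show ?case
    unfolding R_seq_Suc[OF step(1)]
    using stepping_sequence_compose strongly_contiguous_compose by blast
qed

theorem theorem6p2:
  fixes m :: nat
  assumes "m \<ge> 2"
  shows "(stepping_sequence m (R_seq m) \<and> strongly_contiguous m (R_seq m)
          \<and> cyclic_gray_code m (integer_list m (R_seq m)))
       \<and> (\<forall>A B. stepping_sequence (m - 1) A \<and> strongly_contiguous (m - 1) A
            \<and> stepping_sequence (m - 1) B \<and> strongly_contiguous (m - 1) B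
          \<longrightarrow> stepping_sequence m (map Suc A @ [1..<m] @ B)
            \<and> strongly_contiguous m (map Suc A @ [1..<m] @ B))"
proof -
  obtain n where m: "m = Suc n" using assms by (cases m) auto
  have "cyclic_gray_code m (integer_list m (R_seq m))"
    using R_seq_stepping_strongly_contiguous[OF assms] assms
    by (intro cyclic_gray_code_integer_list) auto
  then show ?thesis
    using R_seq_stepping_strongly_contiguous[OF assms]
      stepping_sequence_compose[of n] strongly_contiguous_compose[of n]
    unfolding m diff_Suc_1 by blast
qed

end
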